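(* Fix $d\ge1$. Let $(\mathcal{F},s)$ be a uniformly random $d$-Shuffled Simon's instance of size $n$. Let $\mathcal{A}^{\mathcal{F}}=\Pi\circ U_{d+1}\circ\mathcal{F}\circ U_d\circ\cdots\circ\mathcal{F}\circ U_1$ be any $\mathrm{QNC}_d$ circuit acting on $\mathrm{poly}(n)$ qubits initialised to $|0\cdots0\rangle$, with single-layer unitaries $U_j$ independent of the oracle, polynomially many parallel queries per oracle application, and a final computational-basis measurement $\Pi$. Then $\Pr[s\leftarrow\mathcal{A}^{\mathcal{F}}]\le\mathrm{poly}(n)\cdot2^{-n}$.
   Context: Identify $\{0,1\}^n$ with $\{0,\dots,N-1\}$, $N=2^n$, and embed it in $\{0,1\}^{2n}$ by prefixing $n$ zeros. A $d$-Shuffler for a function $f:\{0,1\}^n\to\{0,1\}^n$ is the tuple of functions $(f_0,\dots,f_d)$ on $\{0,1\}^{2n}\cup\{\perp\}$ sampled as follows: let $t_{-1}=(0,1,\dots,N-1)$; let $t_0,\dots,t_{d-1}$ be independent, each uniformly random among tuples of $N$ distinct elements of $\{0,1\}^{2n}$; let $t_d=(f(0),\dots,f(N-1))$. For $0\le i\le d$: if $x$ is the $j$-th entry of $t_{i-1}$ then $f_i(x)$ is the $j$-th entry of $t_i$; otherwise (including $x=\perp$) $f_i(x)=\perp$. Thus $f_d\circ\cdots\circ f_0(x)=f(x)$ for $x\in\{0,1\}^n$. $d$-Shuffled Simon's instance: sample a uniformly random Simon function $(g,s)$ ($s\ne0^n$, $g$ two-to-one with $g(x)=g(y)\iff y\in\{x,x\oplus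 s\}$), then a $d$-Shuffler $(f_0,\dots,f_d)$ for $g$; $\mathcal{F}$ is the standard (XOR) oracle for $(f_0,\dots,f_d)$ (with $\perp$ encoded as a distinguished string). Goal: output $s$. A single-layer unitary is a product of one- and two-qubit gates on disjoint qubits. *)

theory Defs
  imports Complex_Main "HOL-Computational_Algebra.Polynomial"
begin

text \<open>Basis states of m qubits are naturals x < 2^m; qubit i of x is bit i.\<close>

definition bitof :: "nat \<Rightarrow> nat \<Rightarrow> nat" where
  "bitof i x = x div 2 ^ i mod 2"

definition regval :: "nat list \<Rightarrow> nat \<Rightarrow> nat" where
  "regval ps x = (\<Sum>j<length ps. bitof (ps ! j) x * 2 ^ j)"

definition setreg :: "nat list \<Rightarrow> nat \<Rightarrow> nat \<Rightarrow> nat" where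
  "setreg ps v x = x - (\<Sum>j<length ps. bitof (ps ! j) x * 2 ^ (ps ! j))
                     + (\<Sum>j<length ps. bitof j v * 2 ^ (ps ! j))"

definition unitary_fun :: "nat \<Rightarrow> (nat \<Rightarrow> nat \<Rightarrow> complex) \<Rightarrow> bool" where
  "unitary_fun k G \<longleftrightarrow>
     (\<forall>i<k. \<forall>j<k. (\<Sum>l<k. G i l * cnj (G j l)) = (if i = j then 1 else 0)) \<and>
     (\<forall>i<k. \<forall>j<k. (\<Sum>l<k. cnj (G l i) * G l j) = (if i = j then 1 else 0))"

text \<open>A gate is a list of 1 or 2 qubit positions together with a unitary on them.
  A single layer is a list of gates acting on pairwise disjoint qubits
  (qubits not touched are acted on by the identity).\<close>
type_synonym gate = "nat list \<times> (nat \<Rightarrow> nat \<Rightarrow> complex)"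

definition valid_layer :: "nat \<Rightarrow> gate list \<Rightarrow> bool" where
  "valid_layer m gs \<longleftrightarrow>
     distinct (concat (map fst gs)) \<and> set (concat (map fst gs)) \<subseteq> {..<m} \<and>
     (\<forall>(ps, G) \<in> set gs. (length ps = 1 \<or> length ps = 2) \<and> unitary_fun (2 ^ length ps) G)"

definition layer_entry :: "gate list \<Rightarrow> nat \<Rightarrow> nat \<Rightarrow> complex" where
  "layer_entry gs x y =
     (\<Prod>(ps, G) \<leftarrow> gs. G (regval ps x) (regval ps y)) *
     (if \<forall>i. i \<notin> set (concat (map fst gs)) \<longrightarrow> bitof i x = bitof i y then 1 else 0)"

definition apply_layer :: "nat \<Rightarrow> gate list \<Rightarrow> (nat \<Rightarrow> complex) \<Rightarrow> (nat \<Rightarrow> complex)" where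
  "apply_layer m gs \<psi> = (\<lambda>x. \<Sum>y<2 ^ m. layer_entry gs x y * \<psi> y)"

text \<open>Encoding of {0,1}^{2n} \<union> {\<bottom>} into 2n+1 bits: a string is its value, \<bottom> is 4^n.\<close>
definition enc :: "nat \<Rightarrow> nat option \<Rightarrow> nat" where
  "enc n v = (case v of None \<Rightarrow> 4 ^ n | Some a \<Rightarrow> a)"

text \<open>A query register: (index qubits, input qubits, output qubits).
  Index value i \<le> d selects f_i; other index values act trivially.
  Basis action: |i,a,y> \<mapsto> |i,a,y xor enc(f_i(a))>.\<close>
type_synonym query = "nat list \<times> nat list \<times> nat list"

definition query_map :: "nat \<Rightarrow> (nat \<Rightarrow> nat option) list \<Rightarrow> query \<Rightarrow> nat \<Rightarrow> nat" where
  "query_map n fs q x =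
     (case q of (idx, inp, out) \<Rightarrow>
        (let i = regval idx x; a = regval inp x in
         if i < length fs then setreg out (xor (regval out x) (enc n ((fs ! i) a))) x else x))"

definition oracle_map :: "nat \<Rightarrow> (nat \<Rightarrow> nat option) list \<Rightarrow> query list \<Rightarrow> nat \<Rightarrow> nat" where
  "oracle_map n fs qs x = fold (query_map n fs) qs x"

definition valid_queries :: "nat \<Rightarrow> nat \<Rightarrow> query list \<Rightarrow> bool" where
  "valid_queries n m qs \<longleftrightarrow>
     distinct (concat (map (\<lambda>(idx, inp, out). idx @ inp @ out) qs)) \<and>
     set (concat (map (\<lambda>(idx, inp, out). idx @ inp @ out) qs)) \<subseteq> {..<m} \<and>
     (\<forall>(idx, inp, out) \<in> set qs. length inp = 2 * n + 1 \<and> length out = 2 * n + 1)"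

definition apply_oracle :: "nat \<Rightarrow> (nat \<Rightarrow> nat) \<Rightarrow> (nat \<Rightarrow> complex) \<Rightarrow> (nat \<Rightarrow> complex)" where
  "apply_oracle m \<pi> \<psi> = (\<lambda>x. \<Sum>y<2 ^ m. if \<pi> y = x then \<psi> y else 0)"

text \<open>t_{k-1} for k = 0..d+1: t_{-1} = (0..N-1), t_0..t_{d-1} given, t_d = (g(0),...,g(N-1)).\<close>
definition shuf_t :: "nat \<Rightarrow> nat \<Rightarrow> nat list list \<Rightarrow> (nat \<Rightarrow> nat) \<Rightarrow> nat \<Rightarrow> nat list" where
  "shuf_t n d ts g k =
     (if k = 0 then [0..<2 ^ n] else if k \<le> d then ts ! (k - 1) else map g [0..<2 ^ n])"

definition shuf_f :: "nat \<Rightarrow> nat \<Rightarrow> nat list list \<Rightarrow> (nat \<Rightarrow> nat) \<Rightarrow> nat \<Rightarrow> nat \<Rightarrow> nat option" where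
  "shuf_f n d ts g i x =
     (if x \<in> set (shuf_t n d ts g i)
      then Some (shuf_t n d ts g (i + 1) ! (THE j. j < 2 ^ n \<and> shuf_t n d ts g i ! j = x))
      else None)"

definition shuf_fs :: "nat \<Rightarrow> nat \<Rightarrow> nat list list \<Rightarrow> (nat \<Rightarrow> nat) \<Rightarrow> (nat \<Rightarrow> nat option) list" where
  "shuf_fs n d ts g = map (shuf_f n d ts g) [0..<d + 1]"

definition shuf_tuples :: "nat \<Rightarrow> nat \<Rightarrow> nat list list set" where
  "shuf_tuples n d = {ts. length ts = d \<and>
     (\<forall>t \<in> set ts. length t = 2 ^ n \<and> distinct t \<and> set t \<subseteq> {..<4 ^ n})}"

definition simon_pairs :: "nat \<Rightarrow> ((nat \<Rightarrow> nat) \<times> nat) set" where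
  "simon_pairs n = {(g, s). 0 < s \<and> s < 2 ^ n \<and>
     (\<forall>x<2 ^ n. g x < 2 ^ n) \<and> (\<forall>x. 2 ^ n \<le> x \<longrightarrow> g x = 0) \<and>
     (\<forall>x<2 ^ n. \<forall>y<2 ^ n. g x = g y \<longleftrightarrow> (y = x \<or> y = xor x s))}"

text \<open>Circuit: (m qubits, layers U_1..U_{d+1}, query layouts of the d oracle applications,
  output register measured).\<close>
type_synonym circuit = "nat \<times> gate list list \<times> query list list \<times> nat list"

definition valid_circuit :: "nat \<Rightarrow> nat \<Rightarrow> circuit \<Rightarrow> bool" where
  "valid_circuit n d C \<longleftrightarrow>
     (case C of (m, Us, Qs, outr) \<Rightarrow>
        length Us = d + 1 \<and> (\<forall>U \<in> set Us. valid_layer m U) \<and>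
        length Qs = d \<and> (\<forall>qs \<in> set Qs. valid_queries n m qs) \<and>
        length outr = n \<and> distinct outr \<and> set outr \<subseteq> {..<m})"

definition final_state :: "nat \<Rightarrow> nat \<Rightarrow> (nat \<Rightarrow> nat option) list \<Rightarrow> circuit \<Rightarrow> nat \<Rightarrow> complex" where
  "final_state n d fs C =
     (case C of (m, Us, Qs, outr) \<Rightarrow>
        fold (\<lambda>j \<psi>. apply_layer m (Us ! (j + 1)) (apply_oracle m (oracle_map n fs (Qs ! j)) \<psi>))
             [0..<d]
             (apply_layer m (Us ! 0) (\<lambda>x. if x = 0 then 1 else 0)))"

definition success_prob :: "nat \<Rightarrow> nat \<Rightarrow> (nat \<Rightarrow> nat option) list \<Rightarrow> circuit \<Rightarrow> nat \<Rightarrow> real" where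
  "success_prob n d fs C s =
     (case C of (m, Us, Qs, outr) \<Rightarrow>
        (\<Sum>x<2 ^ m. if regval outr x = s then (cmod (final_state n d fs C x))\<^sup>2 else 0))"

definition avg_success :: "nat \<Rightarrow> nat \<Rightarrow> circuit \<Rightarrow> real" where
  "avg_success n d C =
     (\<Sum>(g, s) \<in> simon_pairs n. \<Sum>ts \<in> shuf_tuples n d.
         success_prob n d (shuf_fs n d ts g) C s)
     / (real (card (simon_pairs n)) * real (card (shuf_tuples n d)))"

definition circ_width :: "circuit \<Rightarrow> nat" where
  "circ_width C = fst C"

end

theory Submission
  imports Defs "HOL-Library.FuncSet"
begin

text \<open>Compare the circuit with a run in which oracle application \<open>j\<close> (counted from 0) uses a shadow
  oracle: \<open>f\<^sub>0, \<dots>, f\<^sub>j\<close> answer correctly and every later \<open>f\<^sub>i\<close> always answers \<open>\<bottom>\<close>. The shadow state just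
  before application \<open>j\<close> depends on \<open>t\<^sub>0, \<dots>, t\<^bsub>j-1\<^esub>\<close> only, while it can feel the replacement only by
  querying some \<open>f\<^sub>i\<close>, \<open>j < i\<close>, inside \<open>t\<^bsub>i-1\<^esub>\<close>, a set of density \<open>2\<^sup>-\<^sup>n\<close> independent of that state.
  Hence the expected squared distance of the final states is at most poly(n) \<open>2\<^sup>-\<^sup>n\<close>. The
  shadow run never sees \<open>f\<^sub>d\<close>, so its output is independent of the period. Comparing amplitudes
  (\<open>\<bar>a\<bar>\<^sup>2 \<le> 2 \<bar>b\<bar>\<^sup>2 + 2 \<bar>a - b\<bar>\<^sup>2\<close>) rather than probabilities avoids a square root loss.\<close>

subsection \<open>Registers and bits\<close>

lemma bitof_eq_of_bool: "bitof i x = of_bool (bit x i)"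
  by (simp add: bitof_def bit_iff_odd mod_2_eq_odd)

lemma bitof_eq_iff: "bitof i x = bitof j y \<longleftrightarrow> (bit x i \<longleftrightarrow> bit y j)"
  by (simp add: bitof_eq_of_bool)

text \<open>Distinct powers of two have disjoint binary supports, so the addition never carries and
  each \<open>+\<close> is a bitwise \<open>or\<close>.\<close>

lemma bit_sum_powers:
  assumes "finite A"
  shows "bit (\<Sum>i\<in>A. of_bool (P i) * 2 ^ i :: nat) k \<longleftrightarrow> k \<in> A \<and> P k"
  using assms
proof (induction A arbitrary: k)
  case empty
  then show ?case by simp
next
  case (insert a A)
  let ?S = "\<Sum>i\<in>A. of_bool (P i) * 2 ^ i :: nat"
  show ?case
  proof (cases "P a")
    case True
    have "bit (and (2 ^ a) ?S) l \<longleftrightarrow> False" for l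
      using insert.hyps(2) unfolding bit_and_iff insert.IH bit_exp_iff by auto
    then have "2 ^ a + ?S = or (2 ^ a) ?S"
      by (intro disjunctive_add_eq_or bit_eqI) simp
    then have "(\<Sum>i\<in>insert a A. of_bool (P i) * 2 ^ i :: nat) = or (2 ^ a) ?S"
      using insert.hyps True by simp
    then show ?thesis
      using True by (auto simp only: bit_or_iff insert.IH bit_exp_iff possible_bit_nat)
  next
    case False
    then have "(\<Sum>i\<in>insert a A. of_bool (P i) * 2 ^ i :: nat) = ?S"
      using insert.hyps by simp
    then show ?thesis
      using False by (auto simp only: insert.IH)
  qed
qed

lemma bit_regval: "bit (regval ps x) j \<longleftrightarrow> j < length ps \<and> bit x (ps ! j)"
  unfolding regval_def bitof_eq_of_bool
  using bit_sum_powers[of "{..<length ps}" "\<lambda>j. bit x (ps ! j)" j] by (simp only: finite_lessThan lessThan_iff)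

lemma less_power_iff_bit: "(x :: nat) < 2 ^ m \<longleftrightarrow> (\<forall>i\<ge>m. \<not> bit x i)"
proof -
  have "x < 2 ^ m \<longleftrightarrow> take_bit m x = x"
    by (simp add: take_bit_nat_eq_self_iff)
  also have "\<dots> \<longleftrightarrow> (\<forall>i\<ge>m. \<not> bit x i)"
    by (simp add: bit_eq_iff bit_take_bit_iff not_less) (metis not_le)
  finally show ?thesis .
qed

lemma regval_less: "regval ps x < 2 ^ length ps"
  by (simp add: less_power_iff_bit bit_regval)

lemma bit_nat_less: "bit (x :: nat) i \<Longrightarrow> i < x"
  using less_power_iff_bit[of x x] less_exp[of x] by (meson not_le)

text \<open>The subtraction in \<open>setreg\<close> does not truncate: the old register contents
  are a summand of \<open>x\<close>. What remains lives on the positions outside \<open>ps\<close>,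
  so adding the new contents causes no carry.\<close>

lemma bit_setreg:
  assumes "distinct ps"
  shows "bit (setreg ps v x) i \<longleftrightarrow>
    (if i \<in> set ps then \<exists>j<length ps. ps ! j = i \<and> bit v j else bit x i)"
proof -
  let ?f = "\<lambda>i. of_bool (bit x i) * 2 ^ i :: nat"
  let ?P = "\<lambda>i. \<exists>j<length ps. ps ! j = i \<and> bit v j"
  \<comment> \<open>A finite set of positions containing every set bit of \<open>x\<close>, as these
    lie below \<open>x\<close> itself. Adjoining \<open>set ps\<close> makes the split at the
    register a subset difference.\<close>
  let ?B = "{..<x} \<union> set ps"
  have bij: "bij_betw (\<lambda>j. ps ! j) {..<length ps} (set ps)"
    using assms by (rule bij_betw_nth) auto
  have s1: "(\<Sum>j<length ps. bitof (ps ! j) x * 2 ^ (ps ! j)) = sum ?f (set ps)"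
    unfolding bitof_eq_of_bool by (rule sum.reindex_bij_betw[OF bij, of ?f])
  have "?P (ps ! j) \<longleftrightarrow> bit v j" if "j < length ps" for j
    using that assms by (auto simp: nth_eq_iff_index_eq)
  then have "(\<Sum>j<length ps. bitof j v * 2 ^ (ps ! j))
      = (\<Sum>j<length ps. of_bool (?P (ps ! j)) * 2 ^ (ps ! j))"
    unfolding bitof_eq_of_bool by (intro sum.cong) simp_all
  also have "\<dots> = (\<Sum>i\<in>set ps. of_bool (?P i) * 2 ^ i)"
    by (rule sum.reindex_bij_betw[OF bij, of "\<lambda>i. of_bool (?P i) * 2 ^ i :: nat"])
  finally have s2: "(\<Sum>j<length ps. bitof j v * 2 ^ (ps ! j))
      = (\<Sum>i\<in>set ps. of_bool (?P i) * 2 ^ i)" .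
  have fin: "finite (?B - set ps)" "finite (set ps)" by auto
  have "x = sum ?f ?B"
  proof (rule bit_eqI)
    fix k
    have "finite ?B" by simp
    then show "bit x k \<longleftrightarrow> bit (sum ?f ?B) k"
      using bit_nat_less[of x k] by (simp only: bit_sum_powers) blast
  qed
  also have "\<dots> = sum ?f (?B - set ps) + sum ?f (set ps)"
    by (rule sum.subset_diff) auto
  finally have "setreg ps v x = sum ?f (?B - set ps) + (\<Sum>i\<in>set ps. of_bool (?P i) * 2 ^ i)"
    unfolding setreg_def s1 s2 by linarith
  also have "\<dots> = or (sum ?f (?B - set ps)) (\<Sum>i\<in>set ps. of_bool (?P i) * 2 ^ i)"
    by (intro disjunctive_add_eq_or bit_eqI, simp only: bit_and_iff bit_sum_powers fin) auto
  finally show ?thesis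
    using bit_nat_less[of x i] by (simp only: bit_or_iff bit_sum_powers fin) auto
qed

lemma setreg_less:
  assumes "distinct ps" "set ps \<subseteq> {..<m}" "x < 2 ^ m"
  shows "setreg ps v x < 2 ^ m"
  using assms by (auto simp: less_power_iff_bit bit_setreg)

lemma bit_setreg_nth:
  "distinct ps \<Longrightarrow> j < length ps \<Longrightarrow> bit (setreg ps v x) (ps ! j) \<longleftrightarrow> bit v j"
  by (auto simp: bit_setreg nth_eq_iff_index_eq)

lemma regval_setreg:
  assumes "distinct ps" "v < 2 ^ length ps"
  shows "regval ps (setreg ps v x) = v"
proof -
  have "bit (regval ps (setreg ps v x)) j \<longleftrightarrow> bit v j" for j
    using assms by (cases "j < length ps") (simp_all add: bit_regval bit_setreg_nth less_power_iff_bit)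
  then show ?thesis by (simp add: bit_eq_iff)
qed

lemma regval_cong: "(\<And>i. i \<in> set ps \<Longrightarrow> bit x i \<longleftrightarrow> bit y i) \<Longrightarrow> regval ps x = regval ps y"
  by (rule bit_eqI) (simp add: bit_regval cong: conj_cong)

lemma regval_eq_iff:
  "regval ps x = regval ps y \<longleftrightarrow> (\<forall>i\<in>set ps. bit x i \<longleftrightarrow> bit y i)"
proof
  assume eq: "regval ps x = regval ps y"
  show "\<forall>i\<in>set ps. bit x i \<longleftrightarrow> bit y i"
  proof
    fix i assume "i \<in> set ps"
    then obtain j where "j < length ps" "i = ps ! j" by (metis in_set_conv_nth)
    then show "bit x i \<longleftrightarrow> bit y i"
      using arg_cong[OF eq, of "\<lambda>r. bit r j"] by (simp add: bit_regval)
  qed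
qed (auto intro: regval_cong)

lemma setreg_regval:
  assumes "distinct ps" "\<And>i. i \<notin> set ps \<Longrightarrow> bit x i \<longleftrightarrow> bit y i"
  shows "setreg ps (regval ps x) y = x"
proof -
  have "bit (setreg ps (regval ps x) y) i \<longleftrightarrow> bit x i" for i
    using assms by (cases "i \<in> set ps") (auto simp: bit_setreg bit_regval in_set_conv_nth)
  then show ?thesis by (simp add: bit_eq_iff)
qed

subsection \<open>Norms and layers\<close>

definition norm_sq :: "nat \<Rightarrow> (nat \<Rightarrow> complex) \<Rightarrow> real" where
  "norm_sq m \<psi> = (\<Sum>x<2 ^ m. (cmod (\<psi> x))\<^sup>2)"

lemma norm_sq_cong: "(\<And>x. x < 2 ^ m \<Longrightarrow> \<psi> x = \<phi> x) \<Longrightarrow> norm_sq m \<psi> = norm_sq m \<phi>"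
  by (simp add: norm_sq_def)

lemma cmod_add_sq_le: "(cmod (a + b))\<^sup>2 \<le> 2 * (cmod a)\<^sup>2 + 2 * (cmod b)\<^sup>2"
proof -
  have "(cmod (a + b))\<^sup>2 \<le> (cmod a + cmod b)\<^sup>2"
    by (intro power_mono norm_triangle_ineq norm_ge_zero)
  also have "\<dots> \<le> 2 * (cmod a)\<^sup>2 + 2 * (cmod b)\<^sup>2"
    using zero_le_power2[of "cmod a - cmod b"] by (simp add: power2_eq_square algebra_simps)
  finally show ?thesis .
qed

lemma norm_sq_add_le: "norm_sq m (\<lambda>x. \<psi> x + \<phi> x) \<le> 2 * norm_sq m \<psi> + 2 * norm_sq m \<phi>"
  unfolding norm_sq_def sum_distrib_left sum.distrib[symmetric]
  by (intro sum_mono cmod_add_sq_le)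

lemma norm_sq_diff_le: "norm_sq m (\<lambda>x. \<psi> x - \<phi> x) \<le> 2 * norm_sq m \<psi> + 2 * norm_sq m \<phi>"
  using norm_sq_add_le[of m \<psi> "\<lambda>x. - \<phi> x"] by (simp add: norm_sq_def)

text \<open>Orthonormal columns give an isometry: expand the squares into a triple sum and sum over
  the row index first, so that the Gram matrix appears.\<close>

lemma norm_sq_matrix:
  assumes gram: "\<And>y z. y < 2 ^ m \<Longrightarrow> z < 2 ^ m \<Longrightarrow>
    (\<Sum>x<2 ^ m. cnj (E x y) * E x z) = (if y = z then 1 else 0)"
  shows "norm_sq m (\<lambda>x. \<Sum>y<2 ^ m. E x y * \<psi> y) = norm_sq m \<psi>"
proof -
  have sq: "complex_of_real ((cmod w)\<^sup>2) = cnj w * w" for w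
    by (metis complex_norm_square mult.commute)
  have "complex_of_real (norm_sq m (\<lambda>x. \<Sum>y<2 ^ m. E x y * \<psi> y))
      = (\<Sum>x<2 ^ m. \<Sum>y<2 ^ m. \<Sum>z<2 ^ m. cnj (E x y * \<psi> y) * (E x z * \<psi> z))"
    unfolding norm_sq_def of_real_sum sq cnj_sum sum_product by simp
  also have "\<dots> = (\<Sum>y<2 ^ m. \<Sum>x<2 ^ m. \<Sum>z<2 ^ m. cnj (E x y * \<psi> y) * (E x z * \<psi> z))"
    by (rule sum.swap)
  also have "\<dots> = (\<Sum>y<2 ^ m. \<Sum>z<2 ^ m. \<Sum>x<2 ^ m. cnj (E x y * \<psi> y) * (E x z * \<psi> z))"
    by (rule sum.cong[OF refl], rule sum.swap)
  also have "\<dots> = (\<Sum>y<2 ^ m. \<Sum>z<2 ^ m. cnj (\<psi> y) * \<psi> z * (\<Sum>x<2 ^ m. cnj (E x y) * E x z))"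
    by (simp add: sum_distrib_left mult_ac)
  also have "\<dots> = (\<Sum>y<2 ^ m. \<Sum>z<2 ^ m. cnj (\<psi> y) * \<psi> z * (if y = z then 1 else 0))"
    by (intro sum.cong refl) (simp add: gram)
  also have "\<dots> = (\<Sum>y<2 ^ m. cnj (\<psi> y) * \<psi> y)"
    by (intro sum.cong refl) (simp add: if_distrib cong: if_cong)
  also have "\<dots> = complex_of_real (norm_sq m \<psi>)"
    unfolding norm_sq_def of_real_sum sq ..
  finally show ?thesis by (simp only: of_real_eq_iff)
qed

section \<open>Unitarity of gates and of layers\<close>

definition gate_entry :: "nat list \<Rightarrow> (nat \<Rightarrow> nat \<Rightarrow> complex) \<Rightarrow> nat \<Rightarrow> nat \<Rightarrow> complex" where
  "gate_entry ps G x y =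
     G (regval ps x) (regval ps y) * (if \<forall>i. i \<notin> set ps \<longrightarrow> (bit x i \<longleftrightarrow> bit y i) then 1 else 0)"

text \<open>Here \<open>gate_entry\<close> is \<open>G\<close> tensored with the identity off
  \<open>ps\<close>. Columns differing off \<open>ps\<close> have disjoint supports; otherwise the
  contributing rows are parametrised by the contents of \<open>ps\<close>, and column orthonormality
  of \<open>G\<close> applies.\<close>

lemma gate_entry_gram:
  assumes ps: "distinct ps" "set ps \<subseteq> {..<m}" and G: "unitary_fun (2 ^ length ps) G"
    and y: "y < 2 ^ m" and z: "z < 2 ^ m"
  shows "(\<Sum>x<2 ^ m. cnj (gate_entry ps G x y) * gate_entry ps G x z) = (if y = z then 1 else 0)"
proof (cases "\<forall>i. i \<notin> set ps \<longrightarrow> (bit y i \<longleftrightarrow> bit z i)")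
  case False
  then have "cnj (gate_entry ps G x y) * gate_entry ps G x z = 0" for x
    by (auto simp: gate_entry_def)
  moreover have "y \<noteq> z" using False by auto
  ultimately show ?thesis by (simp only: sum.neutral_const if_False)
next
  case True
  let ?X = "{x. x < 2 ^ m \<and> (\<forall>i. i \<notin> set ps \<longrightarrow> (bit x i \<longleftrightarrow> bit y i))}"
  have bij: "bij_betw (\<lambda>v. setreg ps v y) {..<2 ^ length ps} ?X"
    by (rule bij_betw_byWitness[where f' = "regval ps"])
      (use ps y in \<open>auto simp: regval_setreg setreg_regval regval_less setreg_less bit_setreg\<close>)
  have "(\<Sum>x<2 ^ m. cnj (gate_entry ps G x y) * gate_entry ps G x z)
      = (\<Sum>x\<in>?X. cnj (G (regval ps x) (regval ps y)) * G (regval ps x) (regval ps z))"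
    using True by (intro sum.mono_neutral_cong_right) (auto simp: gate_entry_def)
  also have "\<dots> = (\<Sum>v<2 ^ length ps. cnj (G v (regval ps y)) * G v (regval ps z))"
    by (subst sum.reindex_bij_betw[OF bij, symmetric])
      (intro sum.cong refl, simp add: regval_setreg ps)
  also have "\<dots> = (if regval ps y = regval ps z then 1 else 0)"
    using G regval_less by (simp add: unitary_fun_def)
  also have "regval ps y = regval ps z \<longleftrightarrow> y = z"
    unfolding regval_eq_iff bit_eq_iff[of y z] using True by auto
  finally show ?thesis .
qed

text \<open>Since the gates touch disjoint qubits, only one intermediate \<open>z\<close>
  contributes: it agrees with \<open>y\<close> on \<open>ps\<close> and with \<open>x\<close>
  elsewhere. So a layer is a matrix product of its gates, and norm preservation reduces to single
  gates.\<close>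

lemma layer_entry_Cons:
  assumes "distinct ps" "set ps \<subseteq> {..<m}" "x < 2 ^ m"
    and disj: "set ps \<inter> set (concat (map fst gs)) = {}"
  shows "layer_entry ((ps, G) # gs) x y = (\<Sum>z<2 ^ m. gate_entry ps G x z * layer_entry gs z y)"
proof -
  let ?z = "setreg ps (regval ps y) x"
  have zero: "gate_entry ps G x z * layer_entry gs z y = 0" if "z \<noteq> ?z" for z
  proof (rule ccontr)
    assume "gate_entry ps G x z * layer_entry gs z y \<noteq> 0"
    then have 1: "\<And>i. i \<notin> set ps \<Longrightarrow> bit x i \<longleftrightarrow> bit z i"
      and 2: "\<And>i. i \<notin> set (concat (map fst gs)) \<Longrightarrow> bit z i \<longleftrightarrow> bit y i"
      by (auto simp: gate_entry_def layer_entry_def bitof_eq_iff split: if_splits)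
    have "regval ps z = regval ps y"
      using disj by (intro regval_cong 2) blast
    then have "?z = setreg ps (regval ps z) x" by simp
    also have "\<dots> = z" using assms(1) 1 by (intro setreg_regval) auto
    finally show False using that by simp
  qed
  have zx: "bit ?z i \<longleftrightarrow> bit x i" if "i \<notin> set ps" for i
    using that assms(1) by (simp add: bit_setreg)
  have zy: "bit ?z i \<longleftrightarrow> bit y i" if "i \<in> set ps" for i
    using that assms(1) by (auto simp: bit_setreg bit_regval in_set_conv_nth nth_eq_iff_index_eq)
  have "(\<Prod>(ps, G)\<leftarrow>gs. G (regval ps ?z) (regval ps y)) = (\<Prod>(ps, G)\<leftarrow>gs. G (regval ps x) (regval ps y))"
  proof (intro arg_cong[where f = prod_list] map_cong refl, clarify)
    fix qs H assume "(qs, H) \<in> set gs"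
    then have "set qs \<inter> set ps = {}" using disj by fastforce
    then have "regval qs ?z = regval qs x" by (intro regval_cong zx) blast
    then show "H (regval qs ?z) (regval qs y) = H (regval qs x) (regval qs y)" by simp
  qed
  moreover have "(\<forall>i. i \<notin> set (concat (map fst gs)) \<longrightarrow> bitof i ?z = bitof i y) \<longleftrightarrow>
      (\<forall>i. i \<notin> set (concat (map fst ((ps, G) # gs))) \<longrightarrow> bitof i x = bitof i y)"
    using zx zy by (auto simp: bitof_eq_iff)
  moreover have "gate_entry ps G x ?z = G (regval ps x) (regval ps y)"
    using zx by (simp add: gate_entry_def regval_setreg regval_less assms(1))
  ultimately have "layer_entry ((ps, G) # gs) x y = gate_entry ps G x ?z * layer_entry gs ?z y"
    by (simp add: layer_entry_def mult.assoc)
  also have "\<dots> = (\<Sum>z\<in>{?z}. gate_entry ps G x z * layer_entry gs z y)" by simp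
  also have "\<dots> = (\<Sum>z<2 ^ m. gate_entry ps G x z * layer_entry gs z y)"
    using zero assms by (intro sum.mono_neutral_left) (auto simp: setreg_less)
  finally show ?thesis .
qed

lemma valid_layer_Cons:
  "valid_layer m ((ps, G) # gs) \<longleftrightarrow>
     distinct ps \<and> set ps \<subseteq> {..<m} \<and> set ps \<inter> set (concat (map fst gs)) = {} \<and>
     (length ps = 1 \<or> length ps = 2) \<and> unitary_fun (2 ^ length ps) G \<and> valid_layer m gs"
  by (auto simp: valid_layer_def)

lemma norm_sq_apply_layer:
  assumes "valid_layer m gs"
  shows "norm_sq m (apply_layer m gs \<psi>) = norm_sq m \<psi>"
  using assms
proof (induction gs)
  case Nil
  have "layer_entry [] x y = (if x = y then 1 else 0)" for x y
    by (simp add: layer_entry_def bitof_eq_iff bit_eq_iff[of x y])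
  then show ?case
    by (intro norm_sq_cong) (simp add: apply_layer_def if_distrib[of "\<lambda>u. u * _"] cong: if_cong)
next
  case (Cons g gs)
  obtain ps G where g: "g = (ps, G)" by fastforce
  note v = Cons.prems[unfolded g valid_layer_Cons]
  have "apply_layer m (g # gs) \<psi> x = (\<Sum>z<2 ^ m. gate_entry ps G x z * apply_layer m gs \<psi> z)"
    if "x < 2 ^ m" for x
  proof -
    have "apply_layer m (g # gs) \<psi> x
        = (\<Sum>y<2 ^ m. \<Sum>z<2 ^ m. gate_entry ps G x z * layer_entry gs z y * \<psi> y)"
      unfolding apply_layer_def g
      by (intro sum.cong refl, subst layer_entry_Cons[of ps m]) (use v that in \<open>auto simp: sum_distrib_right\<close>)
    also have "\<dots> = (\<Sum>z<2 ^ m. gate_entry ps G x z * apply_layer m gs \<psi> z)"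
      by (subst sum.swap) (simp add: apply_layer_def sum_distrib_left mult.assoc)
    finally show ?thesis .
  qed
  then have "norm_sq m (apply_layer m (g # gs) \<psi>)
      = norm_sq m (\<lambda>x. \<Sum>z<2 ^ m. gate_entry ps G x z * apply_layer m gs \<psi> z)"
    by (rule norm_sq_cong)
  also have "\<dots> = norm_sq m (apply_layer m gs \<psi>)"
    using v by (intro norm_sq_matrix gate_entry_gram) auto
  finally show ?case using Cons v by simp
qed

lemma apply_layer_diff:
  "apply_layer m gs (\<lambda>x. \<psi> x - \<phi> x) = (\<lambda>x. apply_layer m gs \<psi> x - apply_layer m gs \<phi> x)"
  by (simp add: apply_layer_def right_diff_distrib sum_subtractf)

subsection \<open>Queries and shadow oracles\<close>

lemma query_map_other:
  assumes "distinct out" "i \<notin> set out"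
  shows "bit (query_map n fs (idx, inp, out) x) i \<longleftrightarrow> bit x i"
  using assms by (simp add: query_map_def Let_def bit_setreg)

lemma query_map_less:
  assumes "distinct out" "set out \<subseteq> {..<m}" "x < 2 ^ m"
  shows "query_map n fs (idx, inp, out) x < 2 ^ m"
  using assms by (simp add: query_map_def Let_def setreg_less)

text \<open>A query writes only to \<open>out\<close>, so a second application reads the same index
  and input and XORs the same string away again.\<close>

lemma query_map_involution:
  assumes "distinct (idx @ inp @ out)"
  shows "query_map n fs (idx, inp, out) (query_map n fs (idx, inp, out) x) = x"
proof (cases "regval idx x < length fs")
  case False
  then show ?thesis by (simp add: query_map_def)
next
  case True
  define e where "e = enc n ((fs ! regval idx x) (regval inp x))"
  define y where "y = setreg out (xor (regval out x) e) x"
  have out: "distinct out" using assms by simp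
  have "regval idx y = regval idx x" "regval inp y = regval inp x"
    unfolding y_def using assms by (intro regval_cong; subst bit_setreg; auto)+
  then have qy: "query_map n fs (idx, inp, out) y = setreg out (xor (regval out y) e) y"
    using True by (simp add: query_map_def e_def)
  have "bit (setreg out (xor (regval out y) e) y) i \<longleftrightarrow> bit x i" for i
  proof (cases "i \<in> set out")
    case False
    then show ?thesis using out by (simp add: y_def bit_setreg)
  next
    case True
    then obtain j where j: "j < length out" "i = out ! j" by (metis in_set_conv_nth)
    have "bit y (out ! j) \<longleftrightarrow> (bit x (out ! j) \<noteq> bit e j)"
      using out j by (simp add: y_def bit_setreg_nth bit_xor_iff bit_regval)
    then show ?thesis
      using out j by (auto simp: bit_setreg_nth bit_xor_iff bit_regval)
  qed
  then have "query_map n fs (idx, inp, out) y = x"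
    unfolding qy by (intro bit_eqI)
  moreover have "query_map n fs (idx, inp, out) x = y"
    using True by (simp add: query_map_def e_def y_def)
  ultimately show ?thesis by simp
qed

lemma valid_queries_Cons:
  "valid_queries n m ((idx, inp, out) # qs) \<longleftrightarrow>
     distinct (idx @ inp @ out) \<and> set (idx @ inp @ out) \<subseteq> {..<m} \<and>
     set (idx @ inp @ out) \<inter> set (concat (map (\<lambda>(idx, inp, out). idx @ inp @ out) qs)) = {} \<and>
     length inp = 2 * n + 1 \<and> length out = 2 * n + 1 \<and> valid_queries n m qs"
  unfolding valid_queries_def list.map concat.simps distinct_append[of "_ @ _ @ _"] set_append Un_subset_iff
  by (auto simp del: set_concat)

lemma bij_betw_oracle_map:
  assumes "valid_queries n m qs"
  shows "bij_betw (oracle_map n fs qs) {..<2 ^ m} {..<2 ^ m}"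
  using assms
proof (induction qs)
  case Nil
  then show ?case by (simp add: oracle_map_def bij_betw_def inj_on_def)
next
  case (Cons q qs)
  obtain idx inp out where q: "q = (idx, inp, out)" by (cases q)
  note v = Cons.prems[unfolded q valid_queries_Cons]
  have "bij_betw (query_map n fs q) {..<2 ^ m} {..<2 ^ m}"
    unfolding q by (rule bij_betw_byWitness[where f' = "query_map n fs (idx, inp, out)"])
      (use v in \<open>auto simp: query_map_involution intro!: query_map_less\<close>)
  from bij_betw_trans[OF this Cons.IH] v show ?case
    by (simp add: oracle_map_def comp_def)
qed

text \<open>Every query owns at least one qubit, and different queries share none. Thus a bound on
  the width also bounds the number of parallel queries.\<close>

lemma length_queries_le:
  assumes "valid_queries n m qs"
  shows "length qs \<le> m"
proof -
  let ?c = "concat (map (\<lambda>(idx, inp, out). idx @ inp @ out) qs)"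
  have "\<forall>q\<in>set qs. case q of (idx, inp, out) \<Rightarrow> length inp = 2 * n + 1"
    using assms by (auto simp: valid_queries_def)
  then have "length qs \<le> length ?c"
    by (induction qs) auto
  also have "\<dots> = card (set ?c)"
    using assms by (intro distinct_card[symmetric]) (simp add: valid_queries_def)
  also have "\<dots> \<le> card {..<m}"
    using assms by (intro card_mono) (auto simp: valid_queries_def)
  finally show ?thesis by simp
qed

section \<open>Shadow oracles and the basis states that can notice them\<close>

definition shadow :: "nat \<Rightarrow> (nat \<Rightarrow> nat option) list \<Rightarrow> (nat \<Rightarrow> nat option) list" where
  "shadow k fs = map (\<lambda>i. if i < k then fs ! i else (\<lambda>_. None)) [0..<length fs]"

fun query_hits :: "nat \<Rightarrow> (nat \<Rightarrow> nat option) list \<Rightarrow> query \<Rightarrow> nat \<Rightarrow> bool" where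
  "query_hits k fs (idx, inp, out) x \<longleftrightarrow>
     k \<le> regval idx x \<and> regval idx x < length fs \<and> (fs ! regval idx x) (regval inp x) \<noteq> None"

text \<open>\<open>shadow\<close> keeps the length of the list, so a blinded function still XORs the
  encoding of \<bottom> instead of acting trivially. This agrees with the true oracle wherever the
  true answer is \<bottom>.\<close>

lemma query_map_shadow:
  assumes "\<not> query_hits k fs q x"
  shows "query_map n (shadow k fs) q x = query_map n fs q x"
  using assms by (cases q) (auto simp: query_map_def shadow_def Let_def)

text \<open>Earlier queries of the fold leave the index and input registers of later ones untouched,
  so hits can all be tested on the initial basis state \<open>x\<close>.\<close>

lemma oracle_map_shadow:
  assumes "valid_queries n m qs" "\<forall>q\<in>set qs. \<not> query_hits k fs q x"
  shows "oracle_map n (shadow k fs) qs x = oracle_map n fs qs x"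
  using assms
proof (induction qs arbitrary: x)
  case Nil
  then show ?case by (simp add: oracle_map_def)
next
  case (Cons q qs)
  obtain idx inp out where q: "q = (idx, inp, out)" by (cases q)
  note v = Cons.prems(1)[unfolded q valid_queries_Cons]
  let ?y = "query_map n fs q x"
  have "\<not> query_hits k fs q' ?y" if "q' \<in> set qs" for q'
  proof -
    obtain idx' inp' out' where q': "q' = (idx', inp', out')" by (cases q')
    have "set (idx' @ inp') \<inter> set out = {}"
      using v that[unfolded q'] by fastforce
    then have "regval idx' ?y = regval idx' x" "regval inp' ?y = regval inp' x"
      unfolding q using v by (auto intro!: regval_cong query_map_other)
    then show ?thesis using Cons.prems(2) that by (auto simp: q')
  qed
  then have "oracle_map n (shadow k fs) qs ?y = oracle_map n fs qs ?y"
    using v by (intro Cons.IH) auto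
  then show ?case
    using Cons.prems(2) by (simp add: oracle_map_def query_map_shadow)
qed

subsection \<open>Runs of a circuit\<close>

lemma norm_sq_apply_oracle:
  assumes "bij_betw \<pi> {..<2 ^ m} {..<2 ^ m}"
  shows "norm_sq m (apply_oracle m \<pi> \<psi>) = norm_sq m \<psi>"
proof -
  have "apply_oracle m \<pi> \<psi> = (\<lambda>x. \<Sum>y<2 ^ m. (if \<pi> y = x then 1 else 0) * \<psi> y)"
    unfolding apply_oracle_def by (intro ext sum.cong) auto
  moreover have "norm_sq m (\<lambda>x. \<Sum>y<2 ^ m. (if \<pi> y = x then 1 else 0) * \<psi> y) = norm_sq m \<psi>"
  proof (rule norm_sq_matrix)
    fix y z :: nat assume yz: "y < 2 ^ m" "z < 2 ^ m"
    have less: "\<pi> y < 2 ^ m" using assms yz by (auto dest: bij_betwE)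
    have "(\<Sum>x<2 ^ m. cnj (if \<pi> y = x then 1 else 0) * (if \<pi> z = x then 1 else 0))
        = (\<Sum>x<2 ^ m. if x = \<pi> y then (if \<pi> z = \<pi> y then 1 else 0) else 0 :: complex)"
      by (intro sum.cong) auto
    also have "\<dots> = (if \<pi> z = \<pi> y then 1 else 0)"
      using less by simp
    also have "\<pi> z = \<pi> y \<longleftrightarrow> y = z"
      using assms yz by (auto simp: bij_betw_def inj_on_def)
    finally show "(\<Sum>x<2 ^ m. cnj (if \<pi> y = x then 1 else 0) * (if \<pi> z = x then 1 else 0))
        = (if y = z then 1 else 0 :: complex)" .
  qed
  ultimately show ?thesis by simp
qed

lemma apply_oracle_diff:
  "apply_oracle m \<pi> (\<lambda>x. \<psi> x - \<phi> x) = (\<lambda>x. apply_oracle m \<pi> \<psi> x - apply_oracle m \<pi> \<phi> x)"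
  unfolding apply_oracle_def sum_subtractf[symmetric] by (intro ext sum.cong) auto

text \<open>Outside \<open>B\<close> both permutations move the amplitudes alike and the
  contributions cancel. The remainder is a difference of two vectors, each with the norm of the part
  of \<psi> on \<open>B\<close>, whence the factor 2 + 2.\<close>

lemma norm_sq_apply_oracle_change:
  assumes "bij_betw \<pi> {..<2 ^ m} {..<2 ^ m}" "bij_betw \<pi>' {..<2 ^ m} {..<2 ^ m}"
    and agree: "\<And>x. \<not> B x \<Longrightarrow> \<pi>' x = \<pi> x"
  shows "norm_sq m (\<lambda>x. apply_oracle m \<pi> \<psi> x - apply_oracle m \<pi>' \<psi> x)
    \<le> 4 * norm_sq m (\<lambda>x. if B x then \<psi> x else 0)"
proof -
  let ?b = "\<lambda>x. if B x then \<psi> x else 0"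
  have "apply_oracle m \<pi> \<psi> x - apply_oracle m \<pi>' \<psi> x
      = apply_oracle m \<pi> ?b x - apply_oracle m \<pi>' ?b x" for x
    unfolding apply_oracle_def sum_subtractf[symmetric]
    by (intro sum.cong refl) (use agree in auto)
  then have "norm_sq m (\<lambda>x. apply_oracle m \<pi> \<psi> x - apply_oracle m \<pi>' \<psi> x)
      = norm_sq m (\<lambda>x. apply_oracle m \<pi> ?b x - apply_oracle m \<pi>' ?b x)"
    by simp
  also have "\<dots> \<le> 2 * norm_sq m (apply_oracle m \<pi> ?b) + 2 * norm_sq m (apply_oracle m \<pi>' ?b)"
    by (rule norm_sq_diff_le)
  finally show ?thesis using assms by (simp add: norm_sq_apply_oracle)
qed

text \<open>The permutation may vary with the application index, so true and shadow runs are
  instances of the same recursion.\<close>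

fun run :: "nat \<Rightarrow> gate list list \<Rightarrow> (nat \<Rightarrow> nat \<Rightarrow> nat) \<Rightarrow> nat \<Rightarrow> nat \<Rightarrow> complex" where
  "run m Us \<pi> 0 = apply_layer m (Us ! 0) (\<lambda>x. if x = 0 then 1 else 0)"
| "run m Us \<pi> (Suc j) = apply_layer m (Us ! Suc j) (apply_oracle m (\<pi> j) (run m Us \<pi> j))"

lemma final_state_eq_run:
  "final_state n d fs (m, Us, Qs, outr) = run m Us (\<lambda>j. oracle_map n fs (Qs ! j)) d"
  unfolding final_state_def by (induction d) auto

lemma run_cong: "(\<And>i. i < j \<Longrightarrow> \<pi> i = \<pi>' i) \<Longrightarrow> run m Us \<pi> j = run m Us \<pi>' j"
  by (induction j) auto

lemma norm_sq_run:
  assumes "\<And>i. i \<le> j \<Longrightarrow> valid_layer m (Us ! i)"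
    and "\<And>i. i < j \<Longrightarrow> bij_betw (\<pi> i) {..<2 ^ m} {..<2 ^ m}"
  shows "norm_sq m (run m Us \<pi> j) = 1"
  using assms
proof (induction j)
  case 0
  have "norm_sq m (\<lambda>x. if x = 0 then 1 else 0) = (\<Sum>x::nat<2 ^ m. if x = 0 then 1 else 0)"
    unfolding norm_sq_def by (intro sum.cong) auto
  then show ?case using 0 by (simp add: norm_sq_apply_layer)
next
  case (Suc j)
  then show ?case by (simp add: norm_sq_apply_layer norm_sq_apply_oracle)
qed

text \<open>The error splits into the inherited one, carried along isometrically, and the new one
  made by exchanging the oracles. The new one is measured on the state of the \<pi>' run; in the
  application this is the shadow state, whose independence from the tuples still hidden is what can
  be exploited.\<close>

lemma norm_sq_run_change:
  assumes U: "valid_layer m (Us ! Suc j)"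
    and bij: "bij_betw (\<pi> j) {..<2 ^ m} {..<2 ^ m}" "bij_betw (\<pi>' j) {..<2 ^ m} {..<2 ^ m}"
    and agree: "\<And>x. \<not> B x \<Longrightarrow> \<pi>' j x = \<pi> j x"
  shows "norm_sq m (\<lambda>x. run m Us \<pi> (Suc j) x - run m Us \<pi>' (Suc j) x)
    \<le> 2 * norm_sq m (\<lambda>x. run m Us \<pi> j x - run m Us \<pi>' j x)
      + 8 * norm_sq m (\<lambda>x. if B x then run m Us \<pi>' j x else 0)"
proof -
  let ?\<psi> = "run m Us \<pi> j" and ?\<phi> = "run m Us \<pi>' j"
  let ?O = "apply_oracle m (\<pi> j)" and ?O' = "apply_oracle m (\<pi>' j)"
  have "norm_sq m (\<lambda>x. run m Us \<pi> (Suc j) x - run m Us \<pi>' (Suc j) x)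
      = norm_sq m (\<lambda>x. ?O ?\<psi> x - ?O' ?\<phi> x)"
    using norm_sq_apply_layer[OF U, of "\<lambda>x. ?O ?\<psi> x - ?O' ?\<phi> x"] by (simp add: apply_layer_diff)
  also have "\<dots> = norm_sq m (\<lambda>x. ?O (\<lambda>x. ?\<psi> x - ?\<phi> x) x + (?O ?\<phi> x - ?O' ?\<phi> x))"
    by (simp add: apply_oracle_diff)
  also have "\<dots> \<le> 2 * norm_sq m (?O (\<lambda>x. ?\<psi> x - ?\<phi> x)) + 2 * norm_sq m (\<lambda>x. ?O ?\<phi> x - ?O' ?\<phi> x)"
    by (rule norm_sq_add_le)
  also have "\<dots> \<le> 2 * norm_sq m (\<lambda>x. ?\<psi> x - ?\<phi> x)
      + 2 * (4 * norm_sq m (\<lambda>x. if B x then ?\<phi> x else 0))"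
    using norm_sq_apply_oracle_change[OF bij agree] by (simp add: norm_sq_apply_oracle bij)
  finally show ?thesis by simp
qed

subsection \<open>Random tuples\<close>

lemma four_power_eq: "(4 :: nat) ^ n = 2 ^ (2 * n)"
  by (simp add: power_mult)

lemma xor_less_four_power: "x < 4 ^ n \<Longrightarrow> y < 4 ^ n \<Longrightarrow> xor x y < (4 :: nat) ^ n"
  by (simp add: four_power_eq less_power_iff_bit bit_xor_iff)

lemma xor_twice: "xor (xor x c) c = (x :: nat)"
  by (simp add: xor.assoc)

lemma shuf_tuples_nth:
  assumes "ts \<in> shuf_tuples n d" "l < d"
  shows "length (ts ! l) = 2 ^ n" "distinct (ts ! l)" "set (ts ! l) \<subseteq> {..<4 ^ n}"
  using assms by (auto simp: shuf_tuples_def)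

lemma shuf_tuples_update:
  assumes "ts \<in> shuf_tuples n d" "length t = 2 ^ n" "distinct t" "set t \<subseteq> {..<4 ^ n}"
  shows "ts[l := t] \<in> shuf_tuples n d"
  using assms set_update_subset_insert[of ts l t] by (auto simp: shuf_tuples_def)

text \<open>XOR-ing the l-th tuple with a constant permutes the shufflers, so every string has the same
  chance \<open>2\<^sup>n / 4\<^sup>n\<close> of occurring in that tuple, even weighted by a quantity not depending on it.\<close>

lemma sum_shuf_tuples_hit_eq:
  fixes h :: "nat list list \<Rightarrow> real"
  assumes l: "l < d" and a: "a < 4 ^ n"
    and indep: "\<And>ts t. ts \<in> shuf_tuples n d \<Longrightarrow> h (ts[l := t]) = h ts"
  shows "(\<Sum>ts\<in>shuf_tuples n d. if a \<in> set (ts ! l) then h ts else 0)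
    = (\<Sum>ts\<in>shuf_tuples n d. h ts) / 2 ^ n" (is "?L = ?H / _")
proof -
  let ?T = "shuf_tuples n d"
  define sh where "sh c ts = ts[l := map (\<lambda>v. xor v c) (ts ! l)]" for c :: nat and ts
  have sh_mem: "sh c ts \<in> ?T" if "c < 4 ^ n" "ts \<in> ?T" for c ts
  proof -
    have "inj (\<lambda>v. xor v c)" by (rule inj_on_inverseI[of _ "\<lambda>v. xor v c"]) (simp add: xor_twice)
    then show ?thesis
      unfolding sh_def using that shuf_tuples_nth[OF that(2) l]
      by (intro shuf_tuples_update) (auto simp: distinct_map xor_less_four_power intro: inj_on_subset)
  qed
  have len: "l < length ts" if "ts \<in> ?T" for ts
    using that l by (simp add: shuf_tuples_def)
  have sh_sh: "sh c (sh c ts) = ts" if "ts \<in> ?T" for c ts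
    using len[OF that] by (simp add: sh_def comp_def xor_twice)
  have mem_sh: "a \<in> set (sh c ts ! l) \<longleftrightarrow> xor a c \<in> set (ts ! l)" if "ts \<in> ?T" for c ts
    using len[OF that] by (auto simp: sh_def xor_twice intro: rev_image_eqI)
  have shift: "?L = (\<Sum>ts\<in>?T. if xor a c \<in> set (ts ! l) then h ts else 0)" if "c < 4 ^ n" for c
  proof -
    have "bij_betw (sh c) ?T ?T"
      using that by (intro bij_betw_byWitness[where f' = "sh c"]) (auto simp: sh_sh sh_mem)
    from sum.reindex_bij_betw[OF this, symmetric]
    have "?L = (\<Sum>ts\<in>?T. if a \<in> set (sh c ts ! l) then h (sh c ts) else 0)" .
    also have "\<dots> = (\<Sum>ts\<in>?T. if xor a c \<in> set (ts ! l) then h ts else 0)"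
      by (intro sum.cong refl) (simp add: mem_sh, simp add: sh_def indep)
    finally show ?thesis .
  qed
  \<comment> \<open>For a fixed shuffler, \<open>xor a\<close> matches the successful constants
    \<open>c\<close> with the \<open>2 ^ n\<close> entries of the tuple.\<close>
  have count: "(\<Sum>c<4 ^ n. if xor a c \<in> set (ts ! l) then h ts else 0) = 2 ^ n * h ts"
    if "ts \<in> ?T" for ts
  proof -
    note t = shuf_tuples_nth[OF that l]
    have "bij_betw (xor a) {c. c < 4 ^ n \<and> xor a c \<in> set (ts ! l)} (set (ts ! l))"
      using t(3) a by (intro bij_betw_byWitness[where f' = "xor a"])
        (auto simp: xor.assoc[symmetric] xor_less_four_power)
    then have "card {c. c < 4 ^ n \<and> xor a c \<in> set (ts ! l)} = 2 ^ n"
      using t by (simp add: bij_betw_same_card distinct_card)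
    moreover have "(\<Sum>c<4 ^ n. if xor a c \<in> set (ts ! l) then h ts else 0)
        = (\<Sum>c\<in>{c. c < 4 ^ n \<and> xor a c \<in> set (ts ! l)}. h ts)"
      by (intro sum.mono_neutral_cong_right) auto
    ultimately show ?thesis by simp
  qed
  \<comment> \<open>Double counting: all \<open>4 ^ n\<close> shifts give the same sum, and
    exchanging the sums reduces to \<open>count\<close>. One factor \<open>2 ^ n\<close> then
    cancels.\<close>
  have "4 ^ n * ?L = (\<Sum>c<4 ^ n :: nat. ?L)" by simp
  also have "\<dots> = (\<Sum>c<4 ^ n. \<Sum>ts\<in>?T. if xor a c \<in> set (ts ! l) then h ts else 0)"
    by (intro sum.cong refl shift) simp
  also have "\<dots> = (\<Sum>ts\<in>?T. \<Sum>c<4 ^ n. if xor a c \<in> set (ts ! l) then h ts else 0)"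
    by (rule sum.swap)
  also have "\<dots> = 2 ^ n * ?H"
    by (simp add: count sum_distrib_left)
  finally have "2 ^ n * (2 ^ n * ?L) = 2 ^ n * ?H"
    by (simp add: power_mult_distrib[symmetric] mult.assoc[symmetric])
  then show ?thesis by (simp add: field_simps)
qed

text \<open>An input register has \<open>2 * n + 1\<close> qubits and may hold a value of
  \<open>4 ^ n\<close> or more. Such a value occurs in no tuple, so the equality becomes an upper
  bound.\<close>

lemma sum_shuf_tuples_hit_le:
  fixes h :: "nat list list \<Rightarrow> real"
  assumes l: "l < d" and nonneg: "\<And>ts. 0 \<le> h ts"
    and indep: "\<And>ts t. ts \<in> shuf_tuples n d \<Longrightarrow> h (ts[l := t]) = h ts"
  shows "(\<Sum>ts\<in>shuf_tuples n d. if a \<in> set (ts ! l) then h ts else 0)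
    \<le> (\<Sum>ts\<in>shuf_tuples n d. h ts) / 2 ^ n"
proof (cases "a < 4 ^ n")
  case True
  with assms show ?thesis by (simp add: sum_shuf_tuples_hit_eq)
next
  case False
  then have "(\<Sum>ts\<in>shuf_tuples n d. if a \<in> set (ts ! l) then h ts else 0) = 0"
    using shuf_tuples_nth(3)[OF _ l] by (intro sum.neutral) auto
  then show ?thesis by (simp add: sum_nonneg nonneg)
qed

subsection \<open>Distance to the shadow run\<close>

lemma length_shuf_fs: "length (shuf_fs n d ts g) = d + 1"
  by (simp add: shuf_fs_def)

lemma shuf_fs_nth_neq_None:
  assumes "0 < i" "i \<le> d"
  shows "(shuf_fs n d ts g ! i) a \<noteq> None \<longleftrightarrow> a \<in> set (ts ! (i - 1))"
proof -
  have "shuf_fs n d ts g ! i = shuf_f n d ts g i"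
    using assms by (simp add: shuf_fs_def nth_map_upt del: upt_Suc)
  then show ?thesis using assms by (simp add: shuf_f_def shuf_t_def)
qed

text \<open>Each visible function, of index \<open>i < k\<close>, is fixed by the tuples on its two
  sides, which are the initial one or among the first \<open>k\<close> entries of \<open>ts\<close>.
  The values of \<open>g\<close> enter only through the function of index \<open>d\<close>, blinded
  because \<open>k \<le> d\<close>; hence \<open>g\<close> and \<open>g'\<close> may differ.\<close>

lemma shadow_shuf_fs_cong:
  assumes "k \<le> d" "\<And>i. i < k \<Longrightarrow> ts ! i = ts' ! i"
  shows "shadow k (shuf_fs n d ts g) = shadow k (shuf_fs n d ts' g')"
proof (rule nth_equalityI)
  fix i assume "i < length (shadow k (shuf_fs n d ts g))"
  then have i: "i < d + 1" by (simp add: shadow_def length_shuf_fs)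
  have "shuf_fs n d ts g ! i = shuf_fs n d ts' g' ! i" if "i < k"
  proof -
    have "shuf_t n d ts g j = shuf_t n d ts' g' j" if "j \<le> k" for j
      using that assms by (simp add: shuf_t_def)
    then have "shuf_f n d ts g i = shuf_f n d ts' g' i"
      using that by (intro ext) (simp add: shuf_f_def)
    then show ?thesis
      using i by (simp add: shuf_fs_def nth_map_upt del: upt_Suc)
  qed
  then show "shadow k (shuf_fs n d ts g) ! i = shadow k (shuf_fs n d ts' g') ! i"
    using i by (simp add: shadow_def length_shuf_fs nth_map_upt del: upt_Suc)
qed (simp add: shadow_def length_shuf_fs)

section \<open>Hybrid comparison of the true and the shadow run\<close>

definition true_run :: "nat \<Rightarrow> nat \<Rightarrow> circuit \<Rightarrow> (nat \<Rightarrow> nat) \<Rightarrow> nat list list \<Rightarrow> nat \<Rightarrow> nat \<Rightarrow> complex" where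
  "true_run n d C g ts = (case C of (m, Us, Qs, outr) \<Rightarrow>
     run m Us (\<lambda>j. oracle_map n (shuf_fs n d ts g) (Qs ! j)))"

definition shadow_run :: "nat \<Rightarrow> nat \<Rightarrow> circuit \<Rightarrow> (nat \<Rightarrow> nat) \<Rightarrow> nat list list \<Rightarrow> nat \<Rightarrow> nat \<Rightarrow> complex" where
  "shadow_run n d C g ts = (case C of (m, Us, Qs, outr) \<Rightarrow>
     run m Us (\<lambda>j. oracle_map n (shadow (Suc j) (shuf_fs n d ts g)) (Qs ! j)))"

text \<open>The thresholds used before application \<open>j\<close> are at most \<open>j\<close>. At
  \<open>j = d\<close> this makes the final shadow state independent of the Simon function.\<close>

lemma shadow_run_cong:
  assumes "j \<le> d" "\<And>i. i < j \<Longrightarrow> ts ! i = ts' ! i"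
  shows "shadow_run n d C g ts j = shadow_run n d C g' ts' j"
proof -
  have "shadow (Suc i) (shuf_fs n d ts g) = shadow (Suc i) (shuf_fs n d ts' g')" if "i < j" for i
    using that assms by (intro shadow_shuf_fs_cong) auto
  then show ?thesis
    unfolding shadow_run_def by (auto split: prod.split intro!: run_cong)
qed

lemma valid_circuitD:
  assumes "valid_circuit n d (m, Us, Qs, outr)"
  shows "j \<le> d \<Longrightarrow> valid_layer m (Us ! j)" "j < d \<Longrightarrow> valid_queries n m (Qs ! j)"
  using assms by (auto simp: valid_circuit_def)

lemma norm_sq_shadow_run:
  assumes "valid_circuit n d C" "j \<le> d"
  shows "norm_sq (circ_width C) (shadow_run n d C g ts j) = 1"
proof -
  obtain m Us Qs outr where C: "C = (m, Us, Qs, outr)" by (cases C)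
  show ?thesis
    unfolding C shadow_run_def circ_width_def prod.case fst_conv
    using assms by (intro norm_sq_run bij_betw_oracle_map) (auto simp: C intro: valid_circuitD)
qed

text \<open>Summing over shufflers first, for one basis state at a time, fixes the index and the
  input string, so a hit becomes membership in a single tuple. Summing over basis states afterwards
  restores the unit norm of the shadow state.\<close>

lemma sum_query_hits_le:
  assumes C: "valid_circuit n d C" and j: "j < d"
  shows "(\<Sum>ts\<in>shuf_tuples n d. norm_sq (circ_width C)
      (\<lambda>x. if query_hits (Suc j) (shuf_fs n d ts g) q x then shadow_run n d C g ts j x else 0))
    \<le> real (card (shuf_tuples n d)) / 2 ^ n" (is "?L \<le> _")
proof -
  let ?m = "circ_width C" and ?T = "shuf_tuples n d"
  obtain idx inp out where q: "q = (idx, inp, out)" by (cases q)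
  let ?h = "\<lambda>ts x. (cmod (shadow_run n d C g ts j x))\<^sup>2"
  have single: "(\<Sum>ts\<in>?T. if query_hits (Suc j) (shuf_fs n d ts g) q x then ?h ts x else 0)
      \<le> (\<Sum>ts\<in>?T. ?h ts x) / 2 ^ n" for x
  proof (cases "Suc j \<le> regval idx x \<and> regval idx x \<le> d")
    case False
    then have "\<not> query_hits (Suc j) (shuf_fs n d ts g) q x" for ts
      by (auto simp: q length_shuf_fs)
    then show ?thesis by (simp add: sum_nonneg)
  next
    case True
    \<comment> \<open>The function queried is defined exactly on this tuple. A hit has index at
      least \<open>Suc j\<close>, so \<open>l \<ge> j\<close>, while the shadow state depends only
      on positions below \<open>j\<close>: resampling tuple \<open>l\<close> leaves the weight
      unchanged.\<close>
    define l where "l = regval idx x - 1"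
    have "query_hits (Suc j) (shuf_fs n d ts g) q x \<longleftrightarrow> regval inp x \<in> set (ts ! l)" for ts
      using True shuf_fs_nth_neq_None[of "regval idx x" d n ts g "regval inp x"]
      by (simp add: q length_shuf_fs l_def)
    moreover have "shadow_run n d C g (ts[l := t]) j = shadow_run n d C g ts j" for ts t
      using True j by (intro shadow_run_cong) (auto simp: l_def)
    moreover have "l < d" using True by (auto simp: l_def)
    ultimately show ?thesis
      using sum_shuf_tuples_hit_le[of l d "\<lambda>ts. ?h ts x" n "regval inp x"] by simp
  qed
  have "?L = (\<Sum>ts\<in>?T. \<Sum>x<2 ^ ?m. if query_hits (Suc j) (shuf_fs n d ts g) q x then ?h ts x else 0)"
    unfolding norm_sq_def by (intro sum.cong) auto
  also have "\<dots> = (\<Sum>x<2 ^ ?m. \<Sum>ts\<in>?T. if query_hits (Suc j) (shuf_fs n d ts g) q x then ?h ts x else 0)"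
    by (rule sum.swap)
  also have "\<dots> \<le> (\<Sum>x<2 ^ ?m. (\<Sum>ts\<in>?T. ?h ts x) / 2 ^ n)"
    by (intro sum_mono single)
  also have "\<dots> = (\<Sum>x<2 ^ ?m. \<Sum>ts\<in>?T. ?h ts x) / 2 ^ n"
    by (rule sum_divide_distrib[symmetric])
  also have "(\<Sum>x<2 ^ ?m. \<Sum>ts\<in>?T. ?h ts x) = (\<Sum>ts\<in>?T. norm_sq ?m (shadow_run n d C g ts j))"
    unfolding norm_sq_def by (rule sum.swap)
  also have "\<dots> = real (card ?T)"
    using C j by (simp add: norm_sq_shadow_run)
  finally show ?thesis .
qed

lemma norm_sq_union_bound:
  assumes "finite A"
  shows "norm_sq m (\<lambda>x. if \<exists>q\<in>A. P q x then \<psi> x else 0) \<le> (\<Sum>q\<in>A. norm_sq m (\<lambda>x. if P q x then \<psi> x else 0))"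
proof -
  have "(cmod (if \<exists>q\<in>A. P q x then \<psi> x else 0))\<^sup>2 \<le> (\<Sum>q\<in>A. (cmod (if P q x then \<psi> x else 0))\<^sup>2)" for x
  proof (cases "\<exists>q\<in>A. P q x")
    case True
    then obtain q where "q \<in> A" "P q x" by blast
    with assms member_le_sum[of q A "\<lambda>q. (cmod (if P q x then \<psi> x else 0))\<^sup>2"] True
    show ?thesis by simp
  next
    case False
    then show ?thesis by (simp add: sum_nonneg)
  qed
  then have "norm_sq m (\<lambda>x. if \<exists>q\<in>A. P q x then \<psi> x else 0)
      \<le> (\<Sum>x<2 ^ m. \<Sum>q\<in>A. (cmod (if P q x then \<psi> x else 0))\<^sup>2)"
    unfolding norm_sq_def by (intro sum_mono)
  also have "\<dots> = (\<Sum>q\<in>A. norm_sq m (\<lambda>x. if P q x then \<psi> x else 0))"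
    unfolding norm_sq_def by (rule sum.swap)
  finally show ?thesis .
qed

text \<open>Summed, not averaged, over the shufflers for a fixed \<open>g\<close>; the normalisation
  is left to \<open>avg_success\<close>.\<close>

definition run_distance :: "nat \<Rightarrow> nat \<Rightarrow> circuit \<Rightarrow> (nat \<Rightarrow> nat) \<Rightarrow> nat \<Rightarrow> real" where
  "run_distance n d C g j = (\<Sum>ts\<in>shuf_tuples n d.
     norm_sq (circ_width C) (\<lambda>x. true_run n d C g ts j x - shadow_run n d C g ts j x))"

text \<open>A union bound over the parallel queries, at most as many as there are qubits, each
  contributing \<open>2 ^ n\<close> in the denominator by \<open>sum_query_hits_le\<close>.\<close>

lemma run_distance_Suc_le:
  assumes C: "valid_circuit n d C" and j: "j < d"
  shows "run_distance n d C g (Suc j)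
    \<le> 2 * run_distance n d C g j + 8 * (real (circ_width C) * real (card (shuf_tuples n d)) / 2 ^ n)"
proof -
  let ?T = "shuf_tuples n d"
  obtain m Us Qs outr where Ceq: "C = (m, Us, Qs, outr)" by (cases C)
  have U: "valid_layer m (Us ! Suc j)" and Q: "valid_queries n m (Qs ! j)"
    using C j by (auto simp: Ceq intro: valid_circuitD)
  let ?A = "set (Qs ! j)"
  let ?hit = "\<lambda>ts q x. query_hits (Suc j) (shuf_fs n d ts g) q x"
  let ?D = "\<lambda>j ts. norm_sq m (\<lambda>x. true_run n d C g ts j x - shadow_run n d C g ts j x)"
  let ?b = "\<lambda>ts q. norm_sq m (\<lambda>x. if ?hit ts q x then shadow_run n d C g ts j x else 0)"
  have step: "?D (Suc j) ts \<le> 2 * ?D j ts + 8 * (\<Sum>q\<in>?A. ?b ts q)" for ts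
  proof -
    have "?D (Suc j) ts \<le> 2 * ?D j ts
        + 8 * norm_sq m (\<lambda>x. if \<exists>q\<in>?A. ?hit ts q x then shadow_run n d C g ts j x else 0)"
      unfolding true_run_def shadow_run_def Ceq prod.case
      by (rule norm_sq_run_change[OF U])
        (use Q in \<open>auto intro!: bij_betw_oracle_map oracle_map_shadow\<close>)
    also have "\<dots> \<le> 2 * ?D j ts + 8 * (\<Sum>q\<in>?A. ?b ts q)"
      using norm_sq_union_bound[of ?A m "?hit ts" "shadow_run n d C g ts j"] by simp
    finally show ?thesis .
  qed
  have width: "circ_width C = m" by (simp add: Ceq circ_width_def)
  have "run_distance n d C g (Suc j) \<le> (\<Sum>ts\<in>?T. 2 * ?D j ts + 8 * (\<Sum>q\<in>?A. ?b ts q))"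
    unfolding run_distance_def width by (intro sum_mono step)
  also have "\<dots> = 2 * run_distance n d C g j + 8 * (\<Sum>ts\<in>?T. \<Sum>q\<in>?A. ?b ts q)"
    by (simp add: run_distance_def width sum.distrib sum_distrib_left)
  also have "(\<Sum>ts\<in>?T. \<Sum>q\<in>?A. ?b ts q) = (\<Sum>q\<in>?A. \<Sum>ts\<in>?T. ?b ts q)"
    by (rule sum.swap)
  also have "\<dots> \<le> (\<Sum>q\<in>?A. real (card ?T) / 2 ^ n)"
    using sum_query_hits_le[OF C j] by (intro sum_mono) (simp add: width)
  also have "\<dots> = real (card ?A) * (real (card ?T) / 2 ^ n)" by simp
  also have "\<dots> \<le> real m * (real (card ?T) / 2 ^ n)"
  proof (rule mult_right_mono)
    have "card ?A \<le> m"
      using card_length[of "Qs ! j"] length_queries_le[OF Q] by linarith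
    then show "real (card ?A) \<le> real m" by simp
  qed simp
  finally show ?thesis by (simp add: width)
qed

text \<open>Solves the recurrence with doubling and constant increment, starting from 0 because both
  runs coincide before the first query.\<close>

lemma run_distance_le:
  assumes C: "valid_circuit n d C" and "j \<le> d"
  shows "run_distance n d C g j
    \<le> 8 * (2 ^ j - 1) * (real (circ_width C) * real (card (shuf_tuples n d)) / 2 ^ n)"
  using assms(2)
proof (induction j)
  case 0
  have "true_run n d C g ts 0 = shadow_run n d C g ts 0" for ts
    by (simp add: true_run_def shadow_run_def split: prod.split)
  then show ?case by (simp add: run_distance_def norm_sq_def)
next
  case (Suc j)
  let ?w = "real (circ_width C) * real (card (shuf_tuples n d)) / 2 ^ n"
  have "run_distance n d C g (Suc j) \<le> 2 * run_distance n d C g j + 8 * ?w"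
    using Suc.prems by (intro run_distance_Suc_le C) simp
  also have "\<dots> \<le> 2 * (8 * (2 ^ j - 1) * ?w) + 8 * ?w"
    using Suc by (intro add_right_mono mult_left_mono) auto
  also have "\<dots> = 8 * (2 ^ Suc j - 1) * ?w"
    by (simp add: algebra_simps del: times_divide_eq_right times_divide_eq_left)
  finally show ?case .
qed

subsection \<open>Counting Simon functions\<close>

lemma xor_less_two_power: "x < 2 ^ n \<Longrightarrow> y < 2 ^ n \<Longrightarrow> xor x y < (2 :: nat) ^ n"
  by (simp add: less_power_iff_bit bit_xor_iff)

lemma xor_neq_self: "0 < s \<Longrightarrow> xor x s \<noteq> (x :: nat)"
  by (metis less_not_refl xor.assoc xor.left_neutral xor_self_eq)

text \<open>For a nonzero period below \<open>2 ^ n\<close>, a transversal of the cosets of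
  \<open>{0, s}\<close>: the smaller element of each.\<close>

definition coset_reps :: "nat \<Rightarrow> nat \<Rightarrow> nat set" where
  "coset_reps n s = {x. x < 2 ^ n \<and> x < xor x s}"

text \<open>XOR with \<open>s\<close> is an involution without fixed points that exchanges the
  representatives with the remaining strings.\<close>

lemma card_coset_reps:
  assumes "0 < s" "s < 2 ^ n"
  shows "2 * card (coset_reps n s) = 2 ^ n"
proof -
  let ?R = "coset_reps n s" and ?f = "\<lambda>x. xor x s"
  have fin: "finite ?R" by (simp add: coset_reps_def)
  have "{..<2 ^ n} \<subseteq> ?R \<union> ?f ` ?R"
  proof
    fix x :: nat assume "x \<in> {..<2 ^ n}"
    then have x: "x < 2 ^ n" by simp
    show "x \<in> ?R \<union> ?f ` ?R"
    proof (cases "x < xor x s")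
      case True
      then show ?thesis using x by (simp add: coset_reps_def)
    next
      case False
      then have "xor x s < x" using xor_neq_self[OF assms(1), of x] by linarith
      then have "xor x s \<in> ?R" using x assms by (simp add: coset_reps_def xor_less_two_power xor_twice)
      then have "xor (xor x s) s \<in> ?f ` ?R" by blast
      then show ?thesis by (simp add: xor_twice)
    qed
  qed
  then have eq: "{..<2 ^ n} = ?R \<union> ?f ` ?R"
    using assms by (auto simp: coset_reps_def xor_less_two_power)
  have "card (?f ` ?R) = card ?R"
    by (intro card_image inj_on_inverseI[of _ ?f]) (simp add: xor_twice)
  moreover have "?R \<inter> ?f ` ?R = {}"
    by (auto simp: coset_reps_def xor_twice)
  ultimately show ?thesis
    using arg_cong[OF eq, of card] fin by (simp add: card_Un_disjoint)
qed

text \<open>A Simon function with period s is a free choice of distinct values on the cosets of \<open>{0, s}\<close>,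
  so the number of such functions is the same for all s.\<close>

lemma card_simon_functions:
  assumes s: "0 < s" "s < 2 ^ n"
  shows "finite {g. (g, s) \<in> simon_pairs n}"
    and "card {g. (g, s) \<in> simon_pairs n} = (\<Prod>i<2 ^ n div 2. 2 ^ n - i)"
proof -
  let ?R = "coset_reps n s" and ?G = "{g. (g, s) \<in> simon_pairs n}"
  let ?I = "{f \<in> ?R \<rightarrow>\<^sub>E {..<2 ^ n :: nat}. inj_on f ?R}"
  \<comment> \<open>The inverse of restriction to \<open>?R\<close>: values are copied along each
    coset, and arguments from \<open>2 ^ n\<close> on get the default 0 demanded by
    \<open>simon_pairs\<close>.\<close>
  define ext where "ext f = (\<lambda>x. if x < 2 ^ n then if x \<in> ?R then f x else f (xor x s) else 0)"
    for f :: "nat \<Rightarrow> nat"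
  have other: "xor x s \<in> ?R" if "x < 2 ^ n" "x \<notin> ?R" for x
    using that s xor_neq_self[OF s(1), of x] by (simp add: coset_reps_def xor_less_two_power xor_twice)
  have flip: "xor x s \<notin> ?R" if "x \<in> ?R" for x
    using that by (simp add: coset_reps_def xor_twice)
  have R_less: "x < 2 ^ n" if "x \<in> ?R" for x
    using that by (simp add: coset_reps_def)
  have simonD: "g x < 2 ^ n" "x < 2 ^ n \<Longrightarrow> y < 2 ^ n \<Longrightarrow> g x = g y \<longleftrightarrow> (y = x \<or> y = xor x s)"
    "2 ^ n \<le> x \<Longrightarrow> g x = 0" if "g \<in> ?G" for g x y
    using that by (auto simp: simon_pairs_def) (metis not_le zero_less_numeral zero_less_power)
  have res: "restrict g ?R \<in> ?I" if g: "g \<in> ?G" for g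
  proof -
    have "inj_on g ?R"
    proof (rule inj_onI)
      fix x y assume "x \<in> ?R" "y \<in> ?R" "g x = g y"
      then show "x = y" using simonD(2)[OF g R_less R_less] flip by metis
    qed
    then show ?thesis using simonD(1)[OF g] by (auto simp: inj_on_def)
  qed
  have ext_res: "ext (restrict g ?R) = g" if g: "g \<in> ?G" for g
  proof
    fix x
    show "ext (restrict g ?R) x = g x"
    proof (cases "x < 2 ^ n \<and> x \<notin> ?R")
      case True
      then have "g (xor x s) = g x"
        using simonD(2)[OF g, of x "xor x s"] s by (simp add: xor_less_two_power)
      then show ?thesis using True other by (simp add: ext_def)
    next
      case False
      then show ?thesis using simonD(3)[OF g] by (auto simp: ext_def)
    qed
  qed
  have ext_mem: "ext f \<in> ?G" if f: "f \<in> ?I" for f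
  proof -
    \<comment> \<open>\<open>ext f\<close> factors through \<open>rep\<close>, and \<open>f\<close>
      is injective on representatives, so its collisions are exactly equalities of
      representatives.\<close>
    define rep where "rep x = (if x \<in> ?R then x else xor x s)" for x
    have rep: "rep x \<in> ?R" if "x < 2 ^ n" for x
      using that other by (simp add: rep_def)
    have ext_rep: "ext f x = f (rep x)" if "x < 2 ^ n" for x
      using that by (simp add: ext_def rep_def)
    have "ext f x = ext f y \<longleftrightarrow> (y = x \<or> y = xor x s)" if xy: "x < 2 ^ n" "y < 2 ^ n" for x y
    proof -
      have "ext f x = ext f y \<longleftrightarrow> rep x = rep y"
        using f rep[OF xy(1)] rep[OF xy(2)] xy by (auto simp: ext_rep inj_on_def)
      also have "\<dots> \<longleftrightarrow> (y = x \<or> y = xor x s)"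
        using other[OF xy(1)] other[OF xy(2)] flip[of x] flip[of y] xor_twice[of x s] xor_twice[of y s]
        unfolding rep_def by metis
      finally show ?thesis .
    qed
    moreover have "ext f x < 2 ^ n" if "x < 2 ^ n" for x
      using f rep[OF that] that by (auto simp: ext_rep)
    ultimately show ?thesis
      using s by (simp add: simon_pairs_def) (simp add: ext_def)
  qed
  have res_ext: "restrict (ext f) ?R = f" if f: "f \<in> ?I" for f
    using f R_less by (auto simp: ext_def fun_eq_iff restrict_def PiE_def extensional_def)
  have bij: "bij_betw (\<lambda>g. restrict g ?R) ?G ?I"
    by (rule bij_betw_byWitness[where f' = ext]) (use res ext_res ext_mem res_ext in blast)+
  have fin: "finite ?R" by (simp add: coset_reps_def)
  then have "finite ?I" by (intro finite_subset[OF _ finite_PiE[of ?R "\<lambda>_. {..<2 ^ n}"]]) auto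
  then show "finite ?G" using bij_betw_finite[OF bij] by simp
  have "card ?G = card ?I" by (rule bij_betw_same_card[OF bij])
  also have "\<dots> = prod ((-) (2 ^ n)) {0..<card ?R}"
    using card_inj_on_subset_funcset[OF fin, of "{..<2 ^ n :: nat}" ?R] by simp
  also have "card ?R = 2 ^ n div 2"
    using card_coset_reps[OF s] by linarith
  finally show "card ?G = (\<Prod>i<2 ^ n div 2. 2 ^ n - i)"
    by (simp add: atLeast0LessThan)
qed

text \<open>Grouping by period isolates the sum over \<open>s\<close>, in which the outcomes of one
  fixed state can be added up.\<close>

lemma sum_simon_pairs:
  "(\<Sum>(g, s)\<in>simon_pairs n. F g s) = (\<Sum>s\<in>{0<..<2 ^ n}. \<Sum>g\<in>{g. (g, s) \<in> simon_pairs n}. F g s)"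
proof -
  have "(\<Sum>s\<in>{0<..<2 ^ n}. \<Sum>g\<in>{g. (g, s) \<in> simon_pairs n}. F g s)
      = (\<Sum>(s, g)\<in>(SIGMA s:{0<..<2 ^ n}. {g. (g, s) \<in> simon_pairs n}). F g s)"
    by (rule sum.Sigma) (auto intro: card_simon_functions)
  also have "\<dots> = (\<Sum>(g, s)\<in>simon_pairs n. F g s)"
    by (rule sum.reindex_bij_witness[where i = prod.swap and j = prod.swap])
      (auto simp: simon_pairs_def)
  finally show ?thesis by simp
qed

subsection \<open>Success probability\<close>

definition outcome_prob :: "nat \<Rightarrow> nat list \<Rightarrow> (nat \<Rightarrow> complex) \<Rightarrow> nat \<Rightarrow> real" where
  "outcome_prob m outr \<psi> s = (\<Sum>x<2 ^ m. if regval outr x = s then (cmod (\<psi> x))\<^sup>2 else 0)"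

text \<open>Different register values are mutually exclusive outcomes. A unit vector not depending
  on the period therefore has total success weight at most 1 over all periods together.\<close>

lemma sum_outcome_prob_le: "finite S \<Longrightarrow> (\<Sum>s\<in>S. outcome_prob m outr \<psi> s) \<le> norm_sq m \<psi>"
  unfolding outcome_prob_def norm_sq_def
  by (subst sum.swap, intro sum_mono) simp

lemma outcome_prob_le:
  "outcome_prob m outr \<psi> s \<le> 2 * outcome_prob m outr \<phi> s + 2 * norm_sq m (\<lambda>x. \<psi> x - \<phi> x)"
  unfolding outcome_prob_def norm_sq_def sum_distrib_left sum.distrib[symmetric]
proof (intro sum_mono)
  fix x
  show "(if regval outr x = s then (cmod (\<psi> x))\<^sup>2 else 0)
      \<le> 2 * (if regval outr x = s then (cmod (\<phi> x))\<^sup>2 else 0) + 2 * (cmod (\<psi> x - \<phi> x))\<^sup>2"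
    using cmod_add_sq_le[of "\<phi> x" "\<psi> x - \<phi> x"] by simp
qed

text \<open>The 4 pays for blind guessing among the \<open>2 ^ n - 1\<close> periods, the other term
  for twice the distance between true and shadow run.\<close>

lemma avg_success_le:
  assumes C: "valid_circuit n d C"
  shows "avg_success n d C \<le> (4 + 16 * 2 ^ d * real (circ_width C)) / 2 ^ n"
proof -
  obtain m Us Qs outr where Ceq: "C = (m, Us, Qs, outr)" by (cases C)
  have width: "circ_width C = m" by (simp add: Ceq circ_width_def)
  let ?T = "shuf_tuples n d" and ?S = "simon_pairs n" and ?Z = "{0<..<2 ^ n :: nat}"
  define T where "T = real (card ?T)"
  define K where "K = (\<Prod>i<2 ^ n div 2. 2 ^ n - i :: nat)"
  \<comment> \<open>The zero function is a mere placeholder, since the final shadow state is the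
    same for every \<open>g\<close>.\<close>
  define \<phi> where "\<phi> ts = shadow_run n d C (\<lambda>_. 0) ts d" for ts
  have shadow: "shadow_run n d C g ts d = \<phi> ts" for g ts
    unfolding \<phi>_def by (rule shadow_run_cong) auto
  have succ: "success_prob n d (shuf_fs n d ts g) C s = outcome_prob m outr (true_run n d C g ts d) s"
    for g s ts
    unfolding success_prob_def outcome_prob_def true_run_def Ceq prod.case final_state_eq_run ..
  have inner: "(\<Sum>ts\<in>?T. success_prob n d (shuf_fs n d ts g) C s)
      \<le> 2 * (\<Sum>ts\<in>?T. outcome_prob m outr (\<phi> ts) s) + 16 * 2 ^ d * m / 2 ^ n * T" for g s
  proof -
    have "(\<Sum>ts\<in>?T. success_prob n d (shuf_fs n d ts g) C s)
        \<le> (\<Sum>ts\<in>?T. 2 * outcome_prob m outr (\<phi> ts) s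
            + 2 * norm_sq m (\<lambda>x. true_run n d C g ts d x - shadow_run n d C g ts d x))"
      unfolding succ shadow by (intro sum_mono outcome_prob_le)
    also have "\<dots> = 2 * (\<Sum>ts\<in>?T. outcome_prob m outr (\<phi> ts) s) + 2 * run_distance n d C g d"
      by (simp add: run_distance_def width sum.distrib sum_distrib_left)
    also have "run_distance n d C g d \<le> 8 * (2 ^ d - 1) * (real m * T / 2 ^ n)"
      using run_distance_le[OF C order_refl] by (simp add: width T_def)
    also have "\<dots> \<le> 8 * 2 ^ d * (real m * T / 2 ^ n)"
      by (intro mult_right_mono) (auto simp: T_def)
    finally show ?thesis by (simp add: mult_ac)
  qed
  have outcomes: "(\<Sum>s\<in>?Z. \<Sum>ts\<in>?T. outcome_prob m outr (\<phi> ts) s) \<le> T"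
  proof -
    have "(\<Sum>s\<in>?Z. \<Sum>ts\<in>?T. outcome_prob m outr (\<phi> ts) s)
        = (\<Sum>ts\<in>?T. \<Sum>s\<in>?Z. outcome_prob m outr (\<phi> ts) s)"
      by (rule sum.swap)
    also have "\<dots> \<le> (\<Sum>ts\<in>?T. norm_sq m (\<phi> ts))"
      by (intro sum_mono sum_outcome_prob_le) simp
    also have "\<dots> = T"
      using norm_sq_shadow_run[OF C order_refl] by (simp add: \<phi>_def width T_def)
    finally show ?thesis .
  qed
  have cardG: "card {g. (g, s) \<in> ?S} = K" if "s \<in> ?Z" for s
    using card_simon_functions(2)[of s n] that by (simp add: K_def)
  \<comment> \<open>All \<open>2 ^ n - 1\<close> nonzero periods carry the same number
    \<open>K\<close> of functions, so the period is uniform.\<close>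
  have "real (card ?S) = (\<Sum>(g, s)\<in>?S. 1)" by simp
  also have "\<dots> = real K * (2 ^ n - 1)"
    unfolding sum_simon_pairs using cardG by (simp add: of_nat_diff)
  finally have cardS: "real (card ?S) = real K * (2 ^ n - 1)" .
  have "(\<Sum>(g, s)\<in>?S. \<Sum>ts\<in>?T. success_prob n d (shuf_fs n d ts g) C s)
      \<le> (\<Sum>(g, s)\<in>?S. 2 * (\<Sum>ts\<in>?T. outcome_prob m outr (\<phi> ts) s) + 16 * 2 ^ d * m / 2 ^ n * T)"
    unfolding case_prod_unfold by (intro sum_mono inner)
  also have "\<dots> = 2 * (\<Sum>(g, s)\<in>?S. \<Sum>ts\<in>?T. outcome_prob m outr (\<phi> ts) s)
      + real (card ?S) * (16 * 2 ^ d * m / 2 ^ n * T)"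
    by (simp add: case_prod_unfold sum.distrib sum_distrib_left)
  \<comment> \<open>As \<phi> does not involve \<open>g\<close>, the functions of each period
    contribute just the factor \<open>K\<close>.\<close>
  also have "(\<Sum>(g, s)\<in>?S. \<Sum>ts\<in>?T. outcome_prob m outr (\<phi> ts) s)
      = real K * (\<Sum>s\<in>?Z. \<Sum>ts\<in>?T. outcome_prob m outr (\<phi> ts) s)"
    unfolding sum_simon_pairs sum_distrib_left[of "real K"]
    by (intro sum.cong refl) (simp add: cardG sum_distrib_left)
  also have "\<dots> \<le> real K * T"
    using outcomes by (intro mult_left_mono) auto
  finally have total: "(\<Sum>(g, s)\<in>?S. \<Sum>ts\<in>?T. success_prob n d (shuf_fs n d ts g) C s)
      \<le> 2 * (real K * T) + real (card ?S) * (16 * 2 ^ d * m / 2 ^ n * T)" by simp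
  show ?thesis
  \<comment> \<open>Without instances, as for \<open>n = 0\<close>, the average is a division by
    zero and equals 0.\<close>
  proof (cases "real (card ?S) * T = 0")
    case True
    then show ?thesis by (auto simp: avg_success_def T_def)
  next
    case False
    then have pos: "0 < real (card ?S)" "0 < T" by (auto simp: T_def)
    then have "n \<noteq> 0" unfolding cardS by (intro notI) simp
    then have n: "(2::real) \<le> 2 ^ n"
      using power_increasing[of 1 n "2::real"] by simp
    \<comment> \<open>From \<open>n \<ge> 1\<close>: this replaces the guessing bound 2 /
      (\<open>2 ^ n - 1\<close>) by 4 / \<open>2 ^ n\<close>.\<close>
    have "real K * 2 ^ n \<le> real K * (2 * (2 ^ n - 1))"
      using n by (intro mult_left_mono) auto
    then have "2 * (real K * T) \<le> 4 / 2 ^ n * (real (card ?S) * T)"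
      using pos(2) unfolding cardS by (simp add: field_simps)
    with total have "(\<Sum>(g, s)\<in>?S. \<Sum>ts\<in>?T. success_prob n d (shuf_fs n d ts g) C s)
        \<le> 4 / 2 ^ n * (real (card ?S) * T) + 16 * 2 ^ d * m / 2 ^ n * (real (card ?S) * T)"
      by (simp add: mult_ac)
    also have "\<dots> = (4 + 16 * 2 ^ d * m) / 2 ^ n * (real (card ?S) * T)"
      by (simp add: add_divide_distrib distrib_right)
    finally show ?thesis
      unfolding avg_success_def width T_def[symmetric]
      using pos by (simp add: divide_le_eq)
  qed
qed

theorem mainTheorem5:
  fixes d :: nat
  assumes "d \<ge> 1"
  shows "\<forall>q :: real poly. \<exists>p :: real poly. \<forall>n C.
           valid_circuit n d C \<and> real (circ_width C) \<le> poly q (real n) \<longrightarrow>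
           avg_success n d C \<le> poly p (real n) / 2 ^ n"
proof (intro allI exI impI, elim conjE)
  fix q :: "real poly" and n C
  assume C: "valid_circuit n d C" and width: "real (circ_width C) \<le> poly q (real n)"
  have "avg_success n d C \<le> (4 + 16 * 2 ^ d * real (circ_width C)) / 2 ^ n"
    by (rule avg_success_le[OF C])
  \<comment> \<open>The depth \<open>d\<close> is fixed before the polynomials are chosen, so
    \<open>2 ^ d\<close> is a constant coefficient.\<close>
  also have "\<dots> \<le> poly ([:4:] + smult (16 * 2 ^ d) q) (real n) / 2 ^ n"
    using width by (intro divide_right_mono) auto
  finally show "avg_success n d C \<le> poly ([:4:] + smult (16 * 2 ^ d) q) (real n) / 2 ^ n" .
qed

end
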